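(* Let $\tau=k+\theta$, where $k\in\mathbb{N}_0$ and $\theta\in[0,\tfrac12]$. Let the phase $\alpha\in[\tfrac14,\tfrac34]\pmod 1$ be defined by $c\sin(2\pi\alpha)=u(\theta)$, where $u(\theta)=\pi(2\theta-\tfrac12)$. Then, provided $(\theta,c)\in\mathcal{S}$, where $\mathcal{S}$ is the region defined in the context, the equation $$h'(t)=-\operatorname{sign}(h(t-\tau))+c\cos(2\pi t)$$ admits a symmetric 1:1-periodic solution $h(t)$ with phase $\alpha$, given by $$h(t)=p(t)+\frac{c}{2\pi}\bigl(\sin(2\pi t)-\sin(2\pi\alpha)\bigr),$$ where over a period $t\in[\alpha,\alpha+1)$ $$p(t)=\begin{cases} t-\alpha, & t\in[\alpha,\alpha+\theta),\\ 2\theta-t+\alpha, & t\in[\alpha+\theta,\alpha+\theta+\tfrac12),\\ -1+t-\alpha, & t\in[\alpha+\theta+\tfrac12,\alpha+1).\end{cases}$$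
   Context: Basic notions. $\operatorname{sign}(0)=0$, $\mathbb{N}_0=\{0,1,2,\dots\}$. A solution is a locally absolutely continuous function satisfying the equation for almost every $t$. The set $Z$ of nondegenerate zeros of $h$ consists of all $z$ with $h(z)=0$ for which there is $\delta>0$ with $h(z_-)h(z_+)<0$ for all $z_-\in(z-\delta,z)$, $z_+\in(z,z+\delta)$; $Z^+\subset Z$ is the subset of upward crossings ($h(z_-)<0<h(z_+)$). A 1:1-periodic orbit is a solution on $\mathbb{R}$ of prime period $1$ with finitely many zeros per period and exactly one element of $Z^+$ per period; it is symmetric if $h(t)=-h(t+\tfrac12)$ for all $t$; a phase is any $\alpha\in Z^+$. Constants. The number $\hat\theta\approx0.4695$ is the solution in $[\tfrac14,\tfrac12]$ of $$u(\hat\theta)\sin\Bigl(\sqrt{u^2(\hat\theta)-1}\Bigr)+\cos(2\pi\hat\theta)\sqrt{u^2(\hat\theta)-1}=\sin(2\pi\hat\theta).$$ For $\theta\in[\tfrac14,\hat\theta]$, $w_+^2=w_+^2(\theta)$ denotes the smallest solution (with $w_+^2\ge\max\{1,u^2(\theta)\}$, so that all square roots are real) of $$w_+^2\sin\Bigl(\sqrt{w_+^2-1}\Bigr)=u(\theta)\Bigl(\sin(2\pi\theta)-\cos(2\pi\theta)\sqrt{w_+^2-1}\Bigr)+\sqrt{w_+^2-u^2(\theta)}\Bigl(\sin(2\pi\theta)\sqrt{w_+^2-1}+\cos(2\pi\theta)\Bigr);$$ this is the branch that is strictly increasing on $[\tfrac14,\hat\theta]$ with $w_+^2(\tfrac14)=1$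 and $w_+^2(\hat\theta)=u^2(\hat\theta)$. Region $\mathcal{S}$: the set of all $(\theta,c)\in[\tfrac12-\hat\theta,\hat\theta]\times[0,\infty)$ such that (i') for $\theta\in[\tfrac14,\hat\theta]$: $u^2(\theta)\le c^2\le w_+^2(\theta)$; (ii') for $\theta\in[\tfrac12-\hat\theta,\tfrac14)$: condition (i') with $\theta$ replaced by $\tfrac12-\theta$, i.e. $u^2(\tfrac12-\theta)\le c^2\le w_+^2(\tfrac12-\theta)$. *)

theory Defs
  imports "HOL-Analysis.Analysis"
begin

definition abs_continuous_on :: "real \<Rightarrow> real \<Rightarrow> (real \<Rightarrow> real) \<Rightarrow> bool" where
  "abs_continuous_on a b f \<longleftrightarrow>
     (\<forall>\<epsilon>>0. \<exists>\<delta>>0. \<forall>I :: (real \<times> real) set.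
        finite I \<and> (\<forall>(x, y)\<in>I. a \<le> x \<and> x < y \<and> y \<le> b) \<and>
        pairwise (\<lambda>(x, y) (x', y'). {x<..<y} \<inter> {x'<..<y'} = {}) I \<and>
        (\<Sum>(x, y)\<in>I. y - x) < \<delta>
        \<longrightarrow> (\<Sum>(x, y)\<in>I. \<bar>f y - f x\<bar>) < \<epsilon>)"

definition locally_abs_continuous :: "(real \<Rightarrow> real) \<Rightarrow> bool" where
  "locally_abs_continuous f \<longleftrightarrow> (\<forall>a b. a \<le> b \<longrightarrow> abs_continuous_on a b f)"

definition dde_solution :: "real \<Rightarrow> real \<Rightarrow> (real \<Rightarrow> real) \<Rightarrow> bool" where
  "dde_solution \<tau> c h \<longleftrightarrow>
     locally_abs_continuous h \<and>
     (AE t in lborel.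
        (h has_real_derivative (- sgn (h (t - \<tau>)) + c * cos (2 * pi * t))) (at t))"

definition nondeg_zeros :: "(real \<Rightarrow> real) \<Rightarrow> real set" where
  "nondeg_zeros h =
     {z. h z = 0 \<and> (\<exists>\<delta>>0. \<forall>x\<in>{z - \<delta><..<z}. \<forall>y\<in>{z<..<z + \<delta>}. h x * h y < 0)}"

definition up_zeros :: "(real \<Rightarrow> real) \<Rightarrow> real set" where
  "up_zeros h =
     {z \<in> nondeg_zeros h. \<exists>\<delta>>0. \<forall>x\<in>{z - \<delta><..<z}. \<forall>y\<in>{z<..<z + \<delta>}. h x < 0 \<and> 0 < h y}"

definition prime_period :: "real \<Rightarrow> (real \<Rightarrow> real) \<Rightarrow> bool" where
  "prime_period T h \<longleftrightarrow>
     0 < T \<and> (\<forall>t. h (t + T) = h t) \<and> (\<forall>T'. 0 < T' \<and> T' < T \<longrightarrow> (\<exists>t. h (t + T') \<noteq> h t))"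

definition periodic_orbit_11 :: "real \<Rightarrow> real \<Rightarrow> (real \<Rightarrow> real) \<Rightarrow> bool" where
  "periodic_orbit_11 \<tau> c h \<longleftrightarrow>
     dde_solution \<tau> c h \<and> prime_period 1 h \<and>
     (\<forall>a. finite {t \<in> {a..<a + 1}. h t = 0}) \<and>
     (\<forall>a. \<exists>!z. z \<in> {a..<a + 1} \<and> z \<in> up_zeros h)"

definition symmetric_orbit :: "(real \<Rightarrow> real) \<Rightarrow> bool" where
  "symmetric_orbit h \<longleftrightarrow> (\<forall>t. h t = - h (t + 1/2))"

definition is_phase :: "(real \<Rightarrow> real) \<Rightarrow> real \<Rightarrow> bool" where
  "is_phase h \<alpha> \<longleftrightarrow> \<alpha> \<in> up_zeros h"

definition u_fun :: "real \<Rightarrow> real" where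
  "u_fun \<theta> = pi * (2 * \<theta> - 1/2)"

text \<open>
  The constraint \<open>1 \<le> (u_fun \<theta>)\<^sup>2\<close> makes the square roots in the equation genuine: the
  equation is meant where \<open>u\<^sup>2 - 1\<close> is nonnegative, whereas \<^const>\<open>sqrt\<close> is also defined (as an
  odd function) on negative arguments. The root is unique, about 0.46964.
\<close>
definition theta_hat :: real where
  "theta_hat = (THE \<theta>. \<theta> \<in> {1/4..1/2} \<and> 1 \<le> (u_fun \<theta>)\<^sup>2 \<and>
     u_fun \<theta> * sin (sqrt ((u_fun \<theta>)\<^sup>2 - 1)) + cos (2 * pi * \<theta>) * sqrt ((u_fun \<theta>)\<^sup>2 - 1)
       = sin (2 * pi * \<theta>))"

text \<open>The unknown \<open>x\<close> is the squared quantity \<open>w\<^sub>+\<^sup>2\<close>; only \<open>\<theta> \<in> [1/4, theta_hat]\<close> is meaningful.\<close>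
definition w_plus_sq :: "real \<Rightarrow> real" where
  "w_plus_sq \<theta> = (LEAST x. max 1 ((u_fun \<theta>)\<^sup>2) \<le> x \<and>
     x * sin (sqrt (x - 1))
       = u_fun \<theta> * (sin (2 * pi * \<theta>) - cos (2 * pi * \<theta>) * sqrt (x - 1))
         + sqrt (x - (u_fun \<theta>)\<^sup>2) * (sin (2 * pi * \<theta>) * sqrt (x - 1) + cos (2 * pi * \<theta>)))"

definition region_S :: "(real \<times> real) set" where
  "region_S = {(\<theta>, c). \<theta> \<in> {1/2 - theta_hat..theta_hat} \<and> 0 \<le> c \<and>
     (\<theta> \<in> {1/4..theta_hat} \<longrightarrow> (u_fun \<theta>)\<^sup>2 \<le> c\<^sup>2 \<and> c\<^sup>2 \<le> w_plus_sq \<theta>) \<and>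
     (\<theta> \<in> {1/2 - theta_hat..<1/4} \<longrightarrow>
        (u_fun (1/2 - \<theta>))\<^sup>2 \<le> c\<^sup>2 \<and> c\<^sup>2 \<le> w_plus_sq (1/2 - \<theta>))}"

end

theory Submission
  imports Defs
begin

text \<open>
  With \<open>v = - c cos (2 \<pi> \<alpha>) \<ge> 0\<close> one has \<open>c\<^sup>2 = u\<^sup>2 + v\<^sup>2\<close>, and up to the factor \<open>2 \<pi>\<close> the candidate is
  \<open>x - u (1 - cos x) - v sin x\<close> at the angle \<open>x = 2 \<pi> (t - \<alpha>)\<close> on its first rising piece; from there
  up to \<open>t = \<alpha> + 1/2\<close> it is the same expression at \<open>\<pi> - x\<close> with \<open>u\<close> negated. The reflection
  \<open>\<theta> \<mapsto> 1/2 - \<theta>\<close> negates \<open>u\<close>, so one may take \<open>u \<ge> 0\<close>. For \<open>c \<ge> 1\<close> write \<open>u = c sin \<beta>\<close>, \<open>v = c cos \<beta>\<close>;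
  the only interior local minimum is \<open>\<psi> = \<beta> + arccos (1/c)\<close>, with value \<open>\<psi> - u - q\<close> where
  \<open>q = sqrt (c\<^sup>2 - 1)\<close>. The equation defining \<open>w\<^sub>+\<^sup>2\<close> reads \<open>sin q = sin (\<psi> - u)\<close>, i.e. it describes
  tangency, and below its least root \<open>sin q \<le> sin (\<psi> - u)\<close>, which forces \<open>\<psi> - u \<ge> q\<close>. Hence the
  candidate is nonnegative on the half period after \<open>\<alpha>\<close>, with at most one (degenerate) zero there,
  and antiperiodicity determines the sign of the delayed term almost everywhere.
\<close>

section \<open>Positivity of the gap function\<close>

definition gap :: "real \<Rightarrow> real \<Rightarrow> real \<Rightarrow> real" where
  "gap u v x = x - u * (1 - cos x) - v * sin x"

text \<open>Left minus right side of the equation for \<open>w_plus_sq\<close>, with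
  \<open>sin (2 * pi * \<theta>)\<close> and \<open>cos (2 * pi * \<theta>)\<close> rewritten as
  \<open>cos u\<close> and \<open>- sin u\<close>.\<close>

definition tangency :: "real \<Rightarrow> real \<Rightarrow> real" where
  "tangency u w = w * sin (sqrt (w - 1)) - u * (cos u + sin u * sqrt (w - 1))
     - sqrt (w - u\<^sup>2) * (cos u * sqrt (w - 1) - sin u)"

lemma gap_has_derivative: "(gap u v has_real_derivative 1 - u * sin x - v * cos x) (at x within S)"
  unfolding gap_def by (auto intro!: derivative_eq_intros)

lemma gap_continuous_on: "continuous_on S (gap u v)"
  unfolding gap_def by (intro continuous_intros)

lemma sin_less_self:
  fixes x :: real
  assumes "0 < x"
  shows "sin x < x"
proof (cases "x \<le> 1")
  case True
  have "(0::real) - sin 0 < x - sin x"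
  proof (rule DERIV_pos_imp_increasing_open[OF assms])
    fix t :: real assume "0 < t" "t < x"
    then have "cos t < 1"
      using cos_monotone_0_pi[of 0 t] True pi_gt3 by simp
    then show "\<exists>y. ((\<lambda>x. x - sin x) has_real_derivative y) (at t) \<and> y > 0"
      by (intro exI[of _ "1 - cos t"]) (auto intro!: derivative_eq_intros)
  qed (intro continuous_intros)
  then show ?thesis by simp
next
  case False
  then show ?thesis using sin_le_one[of x] by linarith
qed

text \<open>The \<open>u\<close> term only helps, and \<open>v \<le> 1\<close> reduces the rest to
  \<open>sin x < x\<close>.\<close>

lemma gap_neg_pos:
  assumes "0 \<le> u" "0 \<le> v" "v \<le> 1" "0 < x" "x \<le> pi"
  shows "0 < gap (-u) v x"
proof -
  have "v * sin x \<le> sin x"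
    using mult_right_mono[of v 1 "sin x"] assms sin_ge_zero[of x] by simp
  moreover have "0 \<le> u * (1 - cos x)" using assms by simp
  ultimately show ?thesis
    using sin_less_self[OF assms(4)] by (simp add: gap_def)
qed

text \<open>The gap vanishes at 0 with slope \<open>1 - v\<close>, so \<open>v > 1\<close> would
  make it negative just after 0.\<close>

lemma slope_le_one:
  assumes "\<And>x. 0 < x \<Longrightarrow> x \<le> pi \<Longrightarrow> 0 \<le> gap u v x"
  shows "v \<le> 1"
proof (rule ccontr)
  assume "\<not> v \<le> 1"
  then have "1 - u * sin 0 - v * cos 0 < 0" by simp
  from DERIV_neg_dec_right[OF gap_has_derivative this]
  obtain d where "d > 0" and d: "\<And>h. 0 < h \<Longrightarrow> h < d \<Longrightarrow> gap u v (0 + h) < gap u v 0" by blast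
  define h where "h = min (d/2) pi"
  have "0 < h" "h < d" "h \<le> pi" using \<open>d > 0\<close> by (auto simp: h_def min_def)
  then show False using d[of h] assms[of h] by (simp add: gap_def)
qed

section \<open>Polar form of the tangency condition\<close>

lemma secant_angle:
  fixes c :: real
  assumes "1 \<le> c"
  obtains a where "0 \<le> a" "a < pi/2" "c * cos a = 1" "c * sin a = sqrt (c\<^sup>2 - 1)"
proof -
  define a where "a = arccos (1/c)"
  have c: "0 < 1/c" "1/c \<le> 1" using assms by auto
  have "- 1 \<le> (0::real)" by simp
  then have "- 1 \<le> 1/c" using c(1) by (rule order_trans[OF _ less_imp_le])
  have a: "0 \<le> a" "a < pi/2"
    using c \<open>- 1 \<le> 1/c\<close> arccos_lbound[of "1/c"] arccos_less_arccos[of 0 "1/c"] by (simp_all add: a_def)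
  have "cos a = 1/c" unfolding a_def by (rule cos_arccos[OF \<open>- 1 \<le> 1/c\<close> c(2)])
  then have ca: "c * cos a = 1" using assms by simp
  have "(c * sin a)\<^sup>2 = c\<^sup>2 - (c * cos a)\<^sup>2"
    by (simp add: power_mult_distrib sin_squared_eq algebra_simps)
  moreover have "0 \<le> c * sin a" using assms a by (simp add: sin_ge_zero)
  ultimately have "c * sin a = sqrt (c\<^sup>2 - 1)"
    by (metis ca one_power2 real_sqrt_unique)
  then show ?thesis using that a ca by blast
qed

text \<open>The slope of the gap becomes \<open>1 - c * cos (x - \<beta>)\<close>, so
  \<open>a\<close> is the distance from \<open>\<beta>\<close> to the neighbouring critical
  points.\<close>

lemma phase_angles:
  assumes "0 \<le> u" "0 \<le> v" "1 \<le> u\<^sup>2 + v\<^sup>2"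
  obtains c \<beta> a where "1 \<le> c" "c\<^sup>2 = u\<^sup>2 + v\<^sup>2" "0 \<le> \<beta>" "\<beta> \<le> pi/2" "u = c * sin \<beta>" "v = c * cos \<beta>"
    "0 \<le> a" "a < pi/2" "c * cos a = 1" "c * sin a = sqrt (u\<^sup>2 + v\<^sup>2 - 1)"
proof -
  define c where "c = sqrt (u\<^sup>2 + v\<^sup>2)"
  have c1: "1 \<le> c" using assms(3) by (simp add: c_def)
  have c2: "c\<^sup>2 = u\<^sup>2 + v\<^sup>2" by (simp add: c_def)
  have "(v/c)\<^sup>2 + (u/c)\<^sup>2 = (u\<^sup>2 + v\<^sup>2) / c\<^sup>2"
    by (simp add: power_divide add_divide_distrib)
  also have "\<dots> = 1" using c1 unfolding c2[symmetric] by simp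
  finally have "(v/c)\<^sup>2 + (u/c)\<^sup>2 = 1" .
  then obtain \<beta> where \<beta>: "0 \<le> \<beta>" "\<beta> \<le> pi/2" "v/c = cos \<beta>" "u/c = sin \<beta>"
    using sincos_total_pi_half[of "v/c" "u/c"] assms c1 by auto
  have "u = c * sin \<beta>" "v = c * cos \<beta>" unfolding \<beta>(3,4)[symmetric] using c1 by simp_all
  moreover obtain a where "0 \<le> a" "a < pi/2" "c * cos a = 1" "c * sin a = sqrt (u\<^sup>2 + v\<^sup>2 - 1)"
    using secant_angle[OF c1] unfolding c2 by blast
  ultimately show ?thesis by (rule that[OF c1 c2 \<beta>(1,2)])
qed

text \<open>The root \<open>sqrt (w - u\<^sup>2)\<close> is \<open>v\<close>, and inserting
  \<open>c * cos a = 1\<close> turns the subtracted terms into \<open>c\<^sup>2\<close> times the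
  expansion of \<open>sin (\<beta> + a - u)\<close>.\<close>

lemma tangency_polar:
  assumes "c\<^sup>2 = u\<^sup>2 + v\<^sup>2" "u = c * sin \<beta>" "v = c * cos \<beta>" "0 \<le> v" "c * cos a = 1"
    "c * sin a = sqrt (u\<^sup>2 + v\<^sup>2 - 1)"
  shows "tangency u (u\<^sup>2 + v\<^sup>2) = c\<^sup>2 * (sin (c * sin a) - sin (\<beta> + a - u))"
proof -
  define S where "S = sin u"
  define C where "C = cos u"
  have "tangency u (u\<^sup>2 + v\<^sup>2) =
      c\<^sup>2 * sin (c * sin a) - u * (C + S * (c * sin a)) - v * (C * (c * sin a) - S)"
    unfolding tangency_def S_def C_def using assms(1,4,6) by simp
  also have "\<dots> = c\<^sup>2 * sin (c * sin a)
      - (c * sin \<beta>) * (C * (c * cos a) + S * (c * sin a))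
      - (c * cos \<beta>) * (C * (c * sin a) - S * (c * cos a))"
    using assms(2,3,5) by simp
  also have "\<dots> = c\<^sup>2 * (sin (c * sin a) - sin (\<beta> + a - u))"
    unfolding sin_diff sin_add cos_add S_def[symmetric] C_def[symmetric]
    by (simp add: algebra_simps power2_eq_square)
  finally show ?thesis .
qed

text \<open>The gap is concave up to \<open>\<beta>\<close>, decreases up to
  \<open>\<psi> = \<beta> + a\<close> and increases afterwards, so its value at
  \<open>\<psi>\<close> decides. The upper bound on \<open>u\<^sup>2 + v\<^sup>2\<close> gives
  \<open>c * sin a \<le> pi/2\<close>, which allows sines to be compared through their
  arguments.\<close>

lemma gap_nonneg_of_tangency_le:
  assumes "0 \<le> u" "u \<le> pi/2" "0 \<le> v" "1 \<le> u\<^sup>2 + v\<^sup>2" "u\<^sup>2 + v\<^sup>2 \<le> 1 + (pi/2)\<^sup>2"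
    and "tangency u (u\<^sup>2 + v\<^sup>2) \<le> 0"
  shows "\<exists>\<psi>. \<forall>x. 0 < x \<longrightarrow> x \<le> pi \<longrightarrow> 0 \<le> gap u v x \<and> (gap u v x = 0 \<longrightarrow> x = \<psi>)"
proof -
  obtain c \<beta> a where c: "1 \<le> c" "c\<^sup>2 = u\<^sup>2 + v\<^sup>2" and b: "0 \<le> \<beta>" "\<beta> \<le> pi/2"
    and u: "u = c * sin \<beta>" and v: "v = c * cos \<beta>"
    and a: "0 \<le> a" "a < pi/2" "c * cos a = 1" and q: "c * sin a = sqrt (u\<^sup>2 + v\<^sup>2 - 1)"
    by (rule phase_angles[OF assms(1,3,4)])
  have q0: "0 \<le> c * sin a" using q assms(4) by simp
  have q1: "c * sin a \<le> pi/2"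
    using assms(5) unfolding q by (intro real_le_lsqrt) auto
  have "sin (c * sin a) \<le> sin (\<beta> + a - u)"
    using assms(6) c(1) unfolding tangency_polar[OF c(2) u v assms(3) a(3) q]
    by (simp add: mult_le_0_iff)
  have psi: "c * sin a \<le> \<beta> + a - u"
  proof (rule ccontr)
    assume "\<not> ?thesis"
    then have "sin (\<beta> + a - u) < sin (c * sin a)"
      using q0 q1 a b assms(2) by (intro sin_monotone_2pi) auto
    then show False using \<open>sin (c * sin a) \<le> sin (\<beta> + a - u)\<close> by linarith
  qed
  define \<psi> where "\<psi> = \<beta> + a"
  have deriv: "1 - u * sin x - v * cos x = 1 - c * cos (x - \<beta>)" for x
    unfolding cos_diff by (subst u, subst v) (simp add: algebra_simps)
  have D: "(gap u v has_real_derivative 1 - c * cos (x - \<beta>)) (at x)" for x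
    using gap_has_derivative[of u v x UNIV] unfolding deriv .
  have gap_psi: "0 \<le> gap u v \<psi>"
  proof -
    have "gap u v \<psi> = \<psi> - u + (u * cos \<psi> - v * sin \<psi>)"
      by (simp add: gap_def algebra_simps)
    \<comment> \<open>This is \<open>c * sin (\<beta> - \<psi>)\<close>, so the value at
      \<open>\<psi>\<close> is \<open>\<psi> - u - c * sin a\<close>.\<close>
    also have "u * cos \<psi> - v * sin \<psi> = - (c * sin a) * ((sin \<beta>)\<^sup>2 + (cos \<beta>)\<^sup>2)"
      unfolding \<psi>_def sin_add cos_add using u v by algebra
    finally show ?thesis
      using psi by (simp add: \<psi>_def)
  qed
  have decr: "gap u v \<psi> < gap u v x" if "\<beta> \<le> x" "x < \<psi>" for x
  proof (rule DERIV_neg_imp_decreasing_open[OF that(2) _ gap_continuous_on])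
    fix t assume t: "x < t" "t < \<psi>"
    have "cos a < cos (t - \<beta>)"
      using t that a(2) by (intro cos_monotone_0_pi) (auto simp: \<psi>_def)
    then have "1 < c * cos (t - \<beta>)"
      using mult_strict_left_mono[of "cos a" "cos (t - \<beta>)" c] c a(3) by simp
    then show "\<exists>y. (gap u v has_real_derivative y) (at t) \<and> y < 0"
      by (intro exI[of _ "1 - c * cos (t - \<beta>)"] conjI D) simp
  qed
  have incr: "gap u v \<psi> < gap u v x" if "\<psi> < x" "x \<le> pi" for x
  proof (rule DERIV_pos_imp_increasing_open[OF that(1) _ gap_continuous_on])
    fix t assume t: "\<psi> < t" "t < x"
    have "cos (t - \<beta>) < cos a"
      using t that a b by (intro cos_monotone_0_pi) (auto simp: \<psi>_def)
    then have "c * cos (t - \<beta>) < 1"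
      using mult_strict_left_mono[of "cos (t - \<beta>)" "cos a" c] c a(3) by simp
    then show "\<exists>y. (gap u v has_real_derivative y) (at t) \<and> 0 < y"
      by (intro exI[of _ "1 - c * cos (t - \<beta>)"] conjI D) simp
  qed
  have gap_beta: "0 \<le> gap u v \<beta>"
    using decr[of \<beta>] gap_psi a(1) by (cases "a = 0") (auto simp: \<psi>_def)
  \<comment> \<open>The gap is concave on \<open>[0, \<beta>]\<close> and nonnegative at both ends.\<close>
  have conc: "0 < gap u v x" if x: "0 < x" "x < \<beta>" for x
  proof -
    obtain y where y: "0 < y" "y < x" "gap u v x - gap u v 0 = (x - 0) * (1 - c * cos (y - \<beta>))"
      using MVT2[of 0 x "gap u v", OF x(1) D] by blast
    obtain z where z: "x < z" "z < \<beta>" "gap u v \<beta> - gap u v x = (\<beta> - x) * (1 - c * cos (z - \<beta>))"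
      using MVT2[of x \<beta> "gap u v", OF x(2) D] by blast
    have "cos (\<beta> - y) < cos (\<beta> - z)"
      using y z b by (intro cos_monotone_0_pi) auto
    then have "c * cos (y - \<beta>) < c * cos (z - \<beta>)"
      using c(1) cos_minus[of "\<beta> - y"] cos_minus[of "\<beta> - z"] by simp
    show ?thesis
    proof (rule ccontr)
      assume neg: "\<not> ?thesis"
      moreover have "gap u v 0 = 0" by (simp add: gap_def)
      ultimately have "x * (1 - c * cos (y - \<beta>)) \<le> 0" using y(3) by simp
      then have "1 - c * cos (y - \<beta>) \<le> 0" using x(1) by (simp add: mult_le_0_iff)
      then have "(\<beta> - x) * (1 - c * cos (z - \<beta>)) < 0"
        using x \<open>c * cos (y - \<beta>) < c * cos (z - \<beta>)\<close> by (intro mult_pos_neg) auto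
      then show False using z gap_beta neg by linarith
    qed
  qed
  show ?thesis
  proof (intro exI[of _ \<psi>] allI impI)
    fix x assume x: "0 < x" "x \<le> pi"
    consider "x < \<beta>" | "\<beta> \<le> x" "x < \<psi>" | "x = \<psi>" | "\<psi> < x" by linarith
    then show "0 \<le> gap u v x \<and> (gap u v x = 0 \<longrightarrow> x = \<psi>)"
      by cases (use x conc[of x] decr[of x] incr[of x] gap_psi in auto)
  qed
qed

text \<open>By Cauchy-Schwarz the slope stays positive. This is the case in which no critical angle
  \<open>a\<close> exists.\<close>

lemma gap_pos_of_norm_less_one:
  assumes "u\<^sup>2 + v\<^sup>2 < 1" "0 < x"
  shows "0 < gap u v x"
proof -
  have "gap u v 0 < gap u v x"
  proof (rule DERIV_pos_imp_increasing_open[OF assms(2) _ gap_continuous_on])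
    fix t :: real
    have "(u * sin t + v * cos t)\<^sup>2 + (u * cos t - v * sin t)\<^sup>2
        = (u\<^sup>2 + v\<^sup>2) * ((sin t)\<^sup>2 + (cos t)\<^sup>2)"
      by algebra
    then have "(u * sin t + v * cos t)\<^sup>2 < 1"
      using assms(1) zero_le_power2[of "u * cos t - v * sin t"] by (simp, linarith)
    then have "u * sin t + v * cos t < 1"
      by (metis abs_ge_self abs_square_less_1 order_le_less_trans)
    then show "\<exists>y. (gap u v has_real_derivative y) (at t) \<and> 0 < y"
      using gap_has_derivative[of u v t]
      by (intro exI[of _ "1 - u * sin t - v * cos t"]) auto
  qed
  then show ?thesis by (simp add: gap_def)
qed

section \<open>The critical parameters\<close>

lemma tan_minus_self_mono:
  fixes a b :: real
  assumes "0 \<le> a" "a \<le> b" "b < pi/2"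
  shows "tan a - a \<le> tan b - b"
proof (rule DERIV_nonneg_imp_nondecreasing[OF assms(2)])
  fix x assume x: "a \<le> x" "x \<le> b"
  then have c: "0 < cos x" using assms by (intro cos_gt_zero_pi) auto
  then have "(cos x)\<^sup>2 \<le> 1" by (simp add: power_le_one)
  then have "1 \<le> inverse ((cos x)\<^sup>2)" using c by (simp add: one_le_inverse_iff)
  then show "\<exists>y. ((\<lambda>a. tan a - a) has_real_derivative y) (at x) \<and> 0 \<le> y"
    using c by (intro exI[of _ "inverse ((cos x)\<^sup>2) - 1"]) (auto intro!: derivative_eq_intros)
qed

text \<open>Tangency at \<open>c\<^sup>2 = u\<^sup>2\<close>, i.e. \<open>v = 0\<close>, up to a factor \<open>u\<close>; \<^const>\<open>theta_hat\<close> is its root.\<close>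
definition extremal :: "real \<Rightarrow> real" where
  "extremal u = u * sin (sqrt (u\<^sup>2 - 1)) - sin u * sqrt (u\<^sup>2 - 1) - cos u"

lemma tangency_square: "tangency u (u\<^sup>2) = u * extremal u"
  by (simp add: tangency_def extremal_def algebra_simps power2_eq_square)

lemma extremal_continuous_on: "continuous_on S extremal"
  unfolding extremal_def by (intro continuous_intros)

text \<open>The case \<open>v = 0\<close>, \<open>\<beta> = pi/2\<close>, \<open>c = u\<close> of
  \<open>tangency_polar\<close>, divided by \<open>u\<close>; here \<open>c * sin a\<close> is
  \<open>tan a\<close>.\<close>

lemma extremal_angle:
  assumes "1 \<le> u"
  obtains a where "0 \<le> a" "a < pi/2" "u * cos a = 1" "u * sin a = sqrt (u\<^sup>2 - 1)" "u * sin a = tan a"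
    "extremal u = u * (sin (tan a) - sin (pi/2 + a - u))"
proof -
  obtain a where a: "0 \<le> a" "a < pi/2" and ca: "u * cos a = 1" and q: "u * sin a = sqrt (u\<^sup>2 - 1)"
    by (rule secant_angle[OF assms])
  have s: "u * sin a = tan a"
    using ca by (cases "cos a = 0") (simp_all add: tan_def eq_divide_eq mult.commute mult.left_commute)
  have "tangency u (u\<^sup>2 + 0\<^sup>2) = u\<^sup>2 * (sin (u * sin a) - sin (pi/2 + a - u))"
    by (rule tangency_polar[where v = 0]) (use ca q in auto)
  then have "u * extremal u = u * (u * (sin (tan a) - sin (pi/2 + a - u)))"
    unfolding tangency_square[symmetric] by (simp add: s power2_eq_square mult.assoc)
  then have "extremal u = u * (sin (tan a) - sin (pi/2 + a - u))"
    using assms by simp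
  then show ?thesis using that a ca q s by blast
qed

text \<open>Equal sines leave two possibilities for \<open>tan a\<close>. The supplementary one
  would give \<open>tan a = pi/2 - a + u > u\<close>, whereas
  \<open>tan a = sqrt (u\<^sup>2 - 1) < u\<close>.\<close>

lemma extremal_root_angle:
  assumes "1 \<le> u" "u \<le> pi/2" "extremal u = 0"
  obtains a where "0 \<le> a" "a < pi/2" "u * cos a = 1" "u + tan a = pi/2 + a"
proof -
  obtain a where a: "0 \<le> a" "a < pi/2" "u * cos a = 1" and q: "u * sin a = sqrt (u\<^sup>2 - 1)"
    and s: "u * sin a = tan a" and e: "extremal u = u * (sin (tan a) - sin (pi/2 + a - u))"
    by (rule extremal_angle[OF assms(1)])
  have eq: "sin (tan a) = sin (pi/2 + a - u)" using e assms by simp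
  have t0: "0 \<le> tan a" using s[symmetric] a assms(1) by (simp add: sin_ge_zero)
  have "sqrt (u\<^sup>2 - 1) < sqrt (u\<^sup>2)" by (intro real_sqrt_less_mono) simp
  then have tu: "tan a < u" using s q assms(1) by simp
  show ?thesis
  proof (cases "pi/2 + a - u \<le> pi/2")
    case True
    have "tan a = pi/2 + a - u"
      by (rule sin_inj_pi[OF _ _ _ _ eq]) (use True t0 tu assms a in auto)
    then show ?thesis using that[OF a] by simp
  next
    case False
    have eq': "sin (tan a) = sin (pi - (pi/2 + a - u))" using eq by (simp only: sin_pi_minus)
    have "tan a = pi - (pi/2 + a - u)"
      by (rule sin_inj_pi[OF _ _ _ _ eq']) (use False t0 tu assms a in auto)
    then show ?thesis using tu a by linarith
  qed
qed

text \<open>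
  With \<open>u = 1 / cos a\<close> a root satisfies \<open>u + (tan a - a) = \<pi>/2\<close>, whose left side is strictly
  increasing in \<open>u\<close>.
\<close>
lemma extremal_root_unique:
  assumes "1 \<le> u" "u \<le> pi/2" "extremal u = 0" "1 \<le> u'" "u' \<le> pi/2" "extremal u' = 0"
  shows "u = u'"
proof -
  have False if *: "1 \<le> u" "u \<le> pi/2" "extremal u = 0" "1 \<le> u'" "u' \<le> pi/2" "extremal u' = 0"
    "u < u'" for u u'
  proof -
    obtain a where a: "0 \<le> a" "a < pi/2" "u * cos a = 1" "u + tan a = pi/2 + a"
      by (rule extremal_root_angle[OF *(1-3)])
    obtain b where b: "0 \<le> b" "b < pi/2" "u' * cos b = 1" "u' + tan b = pi/2 + b"
      by (rule extremal_root_angle[OF *(4-6)])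
    have "a \<le> b"
    proof (rule ccontr)
      assume "\<not> a \<le> b"
      then have "cos a \<le> cos b" using a b by (intro cos_monotone_0_pi_le) auto
      then have "u * cos a \<le> u * cos b" "0 < cos b"
        using *(1) b by (auto intro: mult_left_mono cos_gt_zero_pi)
      moreover have "u * cos b < u' * cos b" using \<open>u < u'\<close> \<open>0 < cos b\<close> by simp
      ultimately show False using a b by linarith
    qed
    then show False using tan_minus_self_mono[of a b] a b *(7) by linarith
  qed
  from this[OF assms] this[OF assms(4-6) assms(1-3)] show ?thesis
    by (metis linorder_neqE_linordered_idom)
qed

lemma extremal_one: "extremal 1 < 0"
  using cos_gt_zero_pi[of 1] pi_gt3 by (simp add: extremal_def)

text \<open>Here the polar form compares \<open>sin (tan a)\<close> with \<open>sin a\<close>, and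
  \<open>a \<le> tan a \<le> pi/2\<close>. With \<open>extremal_one\<close> this brackets a
  root.\<close>

lemma extremal_half_pi: "0 \<le> extremal (pi/2)"
proof -
  have "1 \<le> pi/2" using pi_gt3 by simp
  then obtain a where a: "0 \<le> a" "a < pi/2" and q: "pi/2 * sin a = sqrt ((pi/2)\<^sup>2 - 1)"
    and s: "pi/2 * sin a = tan a" and e: "extremal (pi/2) = pi/2 * (sin (tan a) - sin (pi/2 + a - pi/2))"
    by (rule extremal_angle)
  have "a \<le> tan a" using tan_minus_self_mono[of 0 a] a by simp
  moreover have "tan a \<le> pi/2" using s sin_le_one[of a] by (metis mult_left_le pi_half_ge_zero)
  ultimately have "sin a \<le> sin (tan a)" using a by (intro sin_monotone_2pi_le) auto
  then show ?thesis unfolding e by simp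
qed

section \<open>Passage to the variable \<open>u_fun \<theta>\<close> and the root
  \<open>theta_hat\<close>\<close>

lemma sin_u_fun: "sin (2 * pi * \<theta>) = cos (u_fun \<theta>)"
  and cos_u_fun: "cos (2 * pi * \<theta>) = - sin (u_fun \<theta>)"
proof -
  have "2 * pi * \<theta> = u_fun \<theta> + pi/2" by (simp add: u_fun_def algebra_simps)
  then show "sin (2 * pi * \<theta>) = cos (u_fun \<theta>)" "cos (2 * pi * \<theta>) = - sin (u_fun \<theta>)"
    by (simp_all add: sin_add cos_add)
qed

lemma u_fun_le_iff: "u_fun \<theta> \<le> u_fun \<theta>' \<longleftrightarrow> \<theta> \<le> \<theta>'"
  by (simp add: u_fun_def)

lemma u_fun_quarter: "u_fun (1/4) = 0" and u_fun_half: "u_fun (1/2) = pi/2"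
  by (simp_all add: u_fun_def)

text \<open>The definite description is well defined: the intermediate value theorem on
  \<open>[1, pi/2]\<close> gives a root, and \<open>extremal_root_unique\<close> makes it the only
  one.\<close>

lemma theta_hat:
  shows theta_hat_bounds: "1/4 \<le> theta_hat" "theta_hat \<le> 1/2"
    and u_fun_theta_hat_ge_one: "1 \<le> u_fun theta_hat"
    and extremal_theta_hat: "extremal (u_fun theta_hat) = 0"
proof -
  define P where "P \<theta> \<longleftrightarrow> \<theta> \<in> {1/4..1/2} \<and> 1 \<le> u_fun \<theta> \<and> extremal (u_fun \<theta>) = 0" for \<theta>
  have th: "theta_hat = (THE \<theta>. P \<theta>)"
    unfolding theta_hat_def
  proof (rule arg_cong[where f = The], rule ext)
    fix \<theta>
    show "(\<theta> \<in> {1/4..1/2} \<and> 1 \<le> (u_fun \<theta>)\<^sup>2 \<and>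
       u_fun \<theta> * sin (sqrt ((u_fun \<theta>)\<^sup>2 - 1)) + cos (2 * pi * \<theta>) * sqrt ((u_fun \<theta>)\<^sup>2 - 1)
       = sin (2 * pi * \<theta>)) = P \<theta>"
    proof (cases "\<theta> \<in> {1/4..1/2}")
      case True
      then have "0 \<le> u_fun \<theta>" using u_fun_le_iff[of "1/4" \<theta>] by (simp add: u_fun_quarter)
      then have "1 \<le> (u_fun \<theta>)\<^sup>2 \<longleftrightarrow> 1 \<le> u_fun \<theta>"
        using abs_le_square_iff[of 1 "u_fun \<theta>"] by simp
      then show ?thesis
        using True by (auto simp: P_def extremal_def sin_u_fun cos_u_fun)
    qed (auto simp: P_def)
  qed
  have pi2: "1 \<le> pi/2" using pi_gt3 by simp
  obtain u where u: "1 \<le> u" "u \<le> pi/2" "extremal u = 0"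
    using IVT'[OF less_imp_le[OF extremal_one] extremal_half_pi pi2 extremal_continuous_on] by blast
  \<comment> \<open>The preimage of \<open>u\<close> under the affine map
    \<open>u_fun\<close>.\<close>
  define \<theta> where "\<theta> = (u / pi + 1/2) / 2"
  have ut: "u_fun \<theta> = u" by (simp add: u_fun_def \<theta>_def field_simps)
  then have "P \<theta>"
    using u u_fun_le_iff[of "1/4" \<theta>] u_fun_le_iff[of \<theta> "1/2"]
    by (auto simp: P_def u_fun_quarter u_fun_half)
  moreover have "\<theta>' = \<theta>" if "P \<theta>'" for \<theta>'
  proof -
    have "u_fun \<theta>' \<le> pi/2" "1 \<le> u_fun \<theta>'" "extremal (u_fun \<theta>') = 0"
      using that u_fun_le_iff[of \<theta>' "1/2"] by (simp_all add: P_def u_fun_half)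
    then have "u_fun \<theta>' = u_fun \<theta>"
      unfolding ut using u by (metis extremal_root_unique)
    then show ?thesis by (simp add: u_fun_def)
  qed
  ultimately have "P theta_hat" unfolding th by (rule theI)
  then show "1/4 \<le> theta_hat" "theta_hat \<le> 1/2" "1 \<le> u_fun theta_hat" "extremal (u_fun theta_hat) = 0"
    by (simp_all add: P_def)
qed

text \<open>As \<open>extremal\<close> is negative at 1, a positive value would put a root strictly
  before the only root \<open>u_fun theta_hat\<close>.\<close>

lemma extremal_nonpos:
  assumes "1 \<le> u_fun \<theta>" "\<theta> \<le> theta_hat"
  shows "extremal (u_fun \<theta>) \<le> 0"
proof (rule ccontr)
  assume *: "\<not> ?thesis"
  then have "0 \<le> extremal (u_fun \<theta>)" by simp
  then obtain r where r: "1 \<le> r" "r \<le> u_fun \<theta>" "extremal r = 0"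
    using IVT'[OF less_imp_le[OF extremal_one] _ assms(1) extremal_continuous_on] by blast
  have le: "u_fun \<theta> \<le> u_fun theta_hat" "u_fun theta_hat \<le> pi/2"
    using assms(2) theta_hat_bounds u_fun_le_iff[of theta_hat "1/2"] by (simp_all add: u_fun_le_iff u_fun_half)
  have "r = u_fun theta_hat"
    by (rule extremal_root_unique[OF r(1) _ r(3) u_fun_theta_hat_ge_one le(2) extremal_theta_hat])
       (use r le in linarith)
  then have "u_fun \<theta> = u_fun theta_hat" using r le by linarith
  then show False using * extremal_theta_hat by simp
qed

section \<open>The least tangency root \<open>w_plus_sq\<close>\<close>

lemma tangency_continuous_on: "continuous_on S (tangency u)"
  unfolding tangency_def by (intro continuous_intros)

text \<open>For \<open>u \<ge> 1\<close> this is the sign of \<open>extremal\<close>. For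
  \<open>u < 1\<close> the root \<open>sqrt (w - 1)\<close> vanishes, and what remains is
  \<open>- sin (\<beta> - u)\<close> with \<open>\<beta> = arcsin u \<ge> u\<close>.\<close>

lemma tangency_left_end:
  assumes "\<theta> \<in> {1/4..theta_hat}"
  shows "tangency (u_fun \<theta>) (max 1 ((u_fun \<theta>)\<^sup>2)) \<le> 0"
proof (cases "1 \<le> u_fun \<theta>")
  case True
  then have "max 1 ((u_fun \<theta>)\<^sup>2) = (u_fun \<theta>)\<^sup>2"
    using one_le_power by (auto simp: max_def)
  then show ?thesis
    using True assms extremal_nonpos[of \<theta>] by (simp add: tangency_square mult_nonneg_nonpos)
next
  case False
  define u where "u = u_fun \<theta>"
  have u: "0 \<le> u" "u < 1"
    using assms False u_fun_le_iff[of "1/4" \<theta>] by (auto simp: u_def u_fun_quarter)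
  define \<beta> where "\<beta> = arcsin u"
  have sb: "sin \<beta> = u" and cb: "cos \<beta> = sqrt (1 - u\<^sup>2)"
    using u by (simp_all add: \<beta>_def cos_arcsin)
  have "0 \<le> \<beta>" "\<beta> \<le> pi/2"
    using u arcsin_bounded[of u] arcsin_le_arcsin[of 0 u] by (auto simp: \<beta>_def)
  have "u \<le> \<beta>" using sin_x_le_x[OF \<open>0 \<le> \<beta>\<close>] sb by simp
  then have "0 \<le> sin (\<beta> - u)" using u \<open>\<beta> \<le> pi/2\<close> by (intro sin_ge_zero) auto
  then have "0 \<le> u * cos u - sqrt (1 - u\<^sup>2) * sin u" by (simp add: sin_diff sb cb)
  moreover have "u\<^sup>2 \<le> 1" using u by (simp add: power_le_one)
  ultimately show ?thesis
    unfolding u_def[symmetric] by (simp add: tangency_def max_absorb1)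
qed

text \<open>At this value \<open>sqrt (w - 1)\<close> is \<open>pi/2\<close>, where sine attains its
  maximum 1.\<close>

lemma tangency_right_end:
  assumes "0 \<le> u" "u \<le> pi/2"
  shows "0 \<le> tangency u (1 + (pi/2)\<^sup>2)"
proof -
  define v where "v = sqrt (1 + (pi/2)\<^sup>2 - u\<^sup>2)"
  have "u\<^sup>2 \<le> (pi/2)\<^sup>2" using assms by (intro power_mono)
  then have w: "u\<^sup>2 + v\<^sup>2 = 1 + (pi/2)\<^sup>2" and v: "0 \<le> v"
    by (simp_all add: v_def)
  have "1 \<le> u\<^sup>2 + v\<^sup>2" unfolding w by simp
  then obtain c \<beta> a where c: "c\<^sup>2 = u\<^sup>2 + v\<^sup>2"
    and u: "u = c * sin \<beta>" "v = c * cos \<beta>" and a: "c * cos a = 1" and q: "c * sin a = sqrt (u\<^sup>2 + v\<^sup>2 - 1)"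
    by (rule phase_angles[OF assms(1) v])
  have "tangency u (1 + (pi/2)\<^sup>2) = c\<^sup>2 * (sin (c * sin a) - sin (\<beta> + a - u))"
    using tangency_polar[OF c u v a q] unfolding w .
  also have "c * sin a = pi/2" unfolding q w by simp
  finally show ?thesis by simp
qed

text \<open>The roots in \<open>[l, r]\<close> form a nonempty compact set, so \<open>LEAST\<close>
  denotes an actual root. As \<open>tangency\<close> starts nonpositive at \<open>l\<close>, a
  positive value before that root would produce a smaller one.\<close>

lemma w_plus_sq:
  assumes "\<theta> \<in> {1/4..theta_hat}"
  shows w_plus_sq_le: "w_plus_sq \<theta> \<le> 1 + (pi/2)\<^sup>2"
    and tangency_nonpos: "max 1 ((u_fun \<theta>)\<^sup>2) \<le> w \<Longrightarrow> w \<le> w_plus_sq \<theta> \<Longrightarrow> tangency (u_fun \<theta>) w \<le> 0"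
proof -
  define u where "u = u_fun \<theta>"
  define l where "l = max 1 (u\<^sup>2)"
  define r where "r = 1 + (pi/2)\<^sup>2"
  have u: "0 \<le> u" "u \<le> pi/2"
    using assms theta_hat_bounds u_fun_le_iff[of "1/4" \<theta>] u_fun_le_iff[of \<theta> "1/2"]
    by (auto simp: u_def u_fun_quarter u_fun_half)
  have "u\<^sup>2 \<le> (pi/2)\<^sup>2" using u by (intro power_mono)
  then have "l \<le> r" by (simp add: l_def r_def)
  have left: "tangency u l \<le> 0" using tangency_left_end[OF assms] by (simp add: u_def l_def)
  have wp: "w_plus_sq \<theta> = (LEAST x. l \<le> x \<and> tangency u x = 0)"
    unfolding w_plus_sq_def
    unfolding l_def u_def tangency_def sin_u_fun cos_u_fun
    by (rule arg_cong[where f = Least]) (auto simp: fun_eq_iff algebra_simps)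
  define Z where "Z = {x \<in> {l..r}. tangency u x = 0}"
  have "closed Z"
    unfolding Z_def by (intro continuous_closed_preimage_constant tangency_continuous_on closed_atLeastAtMost)
  moreover have "bounded Z"
    by (rule bounded_subset[OF bounded_closed_interval[of l r]]) (auto simp: Z_def)
  ultimately have "compact Z"
    by (simp add: compact_eq_bounded_closed)
  moreover have "Z \<noteq> {}"
    using IVT'[OF left tangency_right_end[OF u, folded r_def] \<open>l \<le> r\<close> tangency_continuous_on]
    by (auto simp: Z_def)
  ultimately obtain m where m: "m \<in> Z" "\<And>x. x \<in> Z \<Longrightarrow> m \<le> x"
    using compact_attains_inf[of Z] by blast
  have least: "w_plus_sq \<theta> = m"
    unfolding wp
  proof (rule Least_equality)
    show "l \<le> m \<and> tangency u m = 0" using m by (simp add: Z_def)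
    fix y assume "l \<le> y \<and> tangency u y = 0"
    then show "m \<le> y" using m by (cases "y \<le> r") (auto simp: Z_def)
  qed
  then show "w_plus_sq \<theta> \<le> 1 + (pi/2)\<^sup>2" using m by (simp add: Z_def r_def)
  show "tangency (u_fun \<theta>) w \<le> 0" if w: "max 1 ((u_fun \<theta>)\<^sup>2) \<le> w" "w \<le> w_plus_sq \<theta>"
  proof (rule ccontr)
    assume *: "\<not> ?thesis"
    then have "0 \<le> tangency u w" by (simp add: u_def)
    moreover have "l \<le> w" using w(1) by (simp add: l_def u_def)
    ultimately obtain x where x: "l \<le> x" "x \<le> w" "tangency u x = 0"
      using IVT'[OF left _ _ tangency_continuous_on] by blast
    then have "m \<le> x" using m w least by (auto simp: Z_def)
    then have "x = w" using x w least by linarith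
    then show False using x * by (simp add: u_def)
  qed
qed

text \<open>Both signs of \<open>u\<close> are recorded because the rising and the falling piece of
  the candidate use opposite ones.\<close>

lemma gap_nonneg_of_region:
  assumes "\<theta> \<in> {1/4..theta_hat}" "0 \<le> v" "(u_fun \<theta>)\<^sup>2 + v\<^sup>2 \<le> w_plus_sq \<theta>"
  shows "\<exists>\<psi>. \<forall>x. 0 < x \<longrightarrow> x \<le> pi \<longrightarrow>
      0 \<le> gap (u_fun \<theta>) v x \<and> (gap (u_fun \<theta>) v x = 0 \<longrightarrow> x = \<psi>) \<and> 0 < gap (- u_fun \<theta>) v x"
proof -
  define u where "u = u_fun \<theta>"
  have u: "0 \<le> u" "u \<le> pi/2"
    using assms theta_hat_bounds u_fun_le_iff[of "1/4" \<theta>] u_fun_le_iff[of \<theta> "1/2"]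
    by (auto simp: u_def u_fun_quarter u_fun_half)
  have "\<exists>\<psi>. \<forall>x. 0 < x \<longrightarrow> x \<le> pi \<longrightarrow> 0 \<le> gap u v x \<and> (gap u v x = 0 \<longrightarrow> x = \<psi>)"
  proof (cases "u\<^sup>2 + v\<^sup>2 < 1")
    case True
    then show ?thesis using gap_pos_of_norm_less_one by (metis less_imp_le less_irrefl)
  next
    case False
    show ?thesis
    proof (rule gap_nonneg_of_tangency_le[OF u assms(2)])
      show "tangency u (u\<^sup>2 + v\<^sup>2) \<le> 0"
        unfolding u_def using False assms by (intro tangency_nonpos) (auto simp: u_def)
    qed (use False w_plus_sq_le[OF assms(1)] assms(3) in \<open>auto simp: u_def\<close>)
  qed
  then obtain \<psi> where \<psi>: "\<And>x. 0 < x \<Longrightarrow> x \<le> pi \<Longrightarrow> 0 \<le> gap u v x \<and> (gap u v x = 0 \<longrightarrow> x = \<psi>)"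
    by blast
  \<comment> \<open>Nonnegativity of the first gap near 0 supplies the bound that the second gap
    requires.\<close>
  have "v \<le> 1" using slope_le_one \<psi> by blast
  then show ?thesis
    using \<psi> gap_neg_pos[OF u(1) assms(2)] unfolding u_def[symmetric] by blast
qed

section \<open>Triangular wave and antiperiodic functions\<close>

definition wave :: "real \<Rightarrow> real" where
  "wave x = \<bar>x - of_int (round x)\<bar>"

text \<open>Any other integer is at distance at least 1 from \<open>n\<close>, hence at least 1/2
  from \<open>x\<close>. At half-integers both neighbours qualify, so adjacent pieces agree
  there.\<close>

lemma wave_eq:
  assumes "\<bar>x - of_int n\<bar> \<le> 1/2"
  shows "wave x = \<bar>x - of_int n\<bar>"
proof -
  have "\<bar>x - of_int n\<bar> \<le> \<bar>x - of_int m\<bar>" for m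
  proof (cases "m = n")
    case False
    then have "1 \<le> \<bar>of_int m - of_int n :: real\<bar>"
      by (metis of_int_abs of_int_diff of_int_1_le_iff eq_iff_diff_eq_0 int_one_le_iff_zero_less zero_less_abs_iff)
    then show ?thesis using assms by linarith
  qed simp
  then show ?thesis
    unfolding wave_def by (intro order_antisym round_diff_minimal)
qed

lemma wave_add_int: "wave (x + of_int n) = wave x"
  using wave_eq[of "x + of_int n" "round x + n"] of_int_round_abs_le[of x]
  by (simp add: wave_def abs_minus_commute)

lemma wave_lipschitz: "\<bar>wave x - wave y\<bar> \<le> \<bar>x - y\<bar>"
proof -
  have "wave x \<le> \<bar>x - y\<bar> + wave y" for x y
    using round_diff_minimal[of x "round y"] unfolding wave_def by linarith
  from this[of x y] this[of y x] show ?thesis by linarith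
qed

text \<open>Antiperiodicity about the mean 1/4, on which the symmetry of the orbit rests.\<close>

lemma wave_add_half: "wave (x + 1/2) = 1/2 - wave x"
proof -
  obtain n :: int where n: "of_int n \<le> x" "x < of_int n + 1" by (metis floor_correct of_int_add of_int_1)
  show ?thesis
  proof (cases "x \<le> of_int n + 1/2")
    case True
    then show ?thesis using n wave_eq[of x n] wave_eq[of "x + 1/2" "n + 1"] by simp
  next
    case False
    then show ?thesis using n wave_eq[of x "n + 1"] wave_eq[of "x + 1/2" "n + 1"] by simp
  qed
qed

lemma wave_deriv_up:
  assumes "of_int n < x" "x < of_int n + 1/2"
  shows "(wave has_real_derivative 1) (at x)"
proof (rule has_field_derivative_transform_within_open[where S = "{of_int n<..<of_int n + 1/2}"])
  show "((\<lambda>x. x - of_int n) has_real_derivative 1) (at x)" by (auto intro!: derivative_eq_intros)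
  show "y - of_int n = wave y" if "y \<in> {of_int n<..<of_int n + 1/2}" for y
    using that wave_eq[of y n] by simp
qed (use assms in auto)

lemma wave_deriv_down:
  assumes "of_int n - 1/2 < x" "x < of_int n"
  shows "(wave has_real_derivative -1) (at x)"
proof (rule has_field_derivative_transform_within_open[where S = "{of_int n - 1/2<..<of_int n}"])
  show "((\<lambda>x. of_int n - x) has_real_derivative -1) (at x)" by (auto intro!: derivative_eq_intros)
  show "of_int n - y = wave y" if "y \<in> {of_int n - 1/2<..<of_int n}" for y
    using that wave_eq[of y n] by simp
qed (use assms in auto)

section \<open>Lipschitz bounds and absolute continuity\<close>

lemma lipschitz_imp_locally_abs_continuous:
  assumes "\<And>x y. \<bar>f x - f y\<bar> \<le> L * \<bar>x - y\<bar>"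
  shows "locally_abs_continuous f"
  unfolding locally_abs_continuous_def abs_continuous_on_def
proof (intro allI impI)
  fix a b \<epsilon> :: real
  assume "0 < \<epsilon>"
  have "0 \<le> L" using assms[of 1 0] by simp
  show "\<exists>\<delta>>0. \<forall>I :: (real \<times> real) set.
        finite I \<and> (\<forall>(x, y)\<in>I. a \<le> x \<and> x < y \<and> y \<le> b) \<and>
        pairwise (\<lambda>(x, y) (x', y'). {x<..<y} \<inter> {x'<..<y'} = {}) I \<and>
        (\<Sum>(x, y)\<in>I. y - x) < \<delta>
        \<longrightarrow> (\<Sum>(x, y)\<in>I. \<bar>f y - f x\<bar>) < \<epsilon>"
  \<comment> \<open>Dividing by \<open>L + 1\<close> covers the case \<open>L = 0\<close>.\<close>
  proof (intro exI[of _ "\<epsilon> / (L + 1)"] conjI allI impI)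
    show "0 < \<epsilon> / (L + 1)" using \<open>0 < \<epsilon>\<close> \<open>0 \<le> L\<close> by simp
    fix I :: "(real \<times> real) set"
    assume I: "finite I \<and> (\<forall>(x, y)\<in>I. a \<le> x \<and> x < y \<and> y \<le> b) \<and>
        pairwise (\<lambda>(x, y) (x', y'). {x<..<y} \<inter> {x'<..<y'} = {}) I \<and>
        (\<Sum>(x, y)\<in>I. y - x) < \<epsilon> / (L + 1)"
    have "(\<Sum>(x, y)\<in>I. \<bar>f y - f x\<bar>) \<le> (\<Sum>(x, y)\<in>I. (L + 1) * (y - x))"
    proof (rule sum_mono, clarify)
      fix x y assume "(x, y) \<in> I"
      then have "x < y" using I by auto
      then show "\<bar>f y - f x\<bar> \<le> (L + 1) * (y - x)"
        using assms[of y x] by (simp add: algebra_simps)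
    qed
    also have "\<dots> = (L + 1) * (\<Sum>(x, y)\<in>I. y - x)"
      by (simp add: sum_distrib_left case_prod_unfold)
    also have "\<dots> < \<epsilon>"
      using I \<open>0 \<le> L\<close> by (simp add: field_simps)
    finally show "(\<Sum>(x, y)\<in>I. \<bar>f y - f x\<bar>) < \<epsilon>" .
  qed
qed

lemma abs_sin_diff_le: "\<bar>sin x - sin y\<bar> \<le> \<bar>x - y\<bar>" for x y :: real
proof -
  have "\<bar>sin x - sin y\<bar> = 2 * \<bar>sin ((x - y) / 2)\<bar> * \<bar>cos ((x + y) / 2)\<bar>"
    by (simp add: sin_diff_sin abs_mult)
  also have "\<dots> \<le> 2 * \<bar>(x - y) / 2\<bar> * 1"
    by (intro mult_mono abs_sin_x_le_abs_x mult_left_mono) auto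
  finally show ?thesis by simp
qed

section \<open>Upward crossings, and antiperiodic functions of known sign\<close>

lemma up_zeros_iff:
  "z \<in> up_zeros h \<longleftrightarrow> h z = 0 \<and>
     (\<exists>\<delta>>0. (\<forall>x. z - \<delta> < x \<longrightarrow> x < z \<longrightarrow> h x < 0) \<and> (\<forall>y. z < y \<longrightarrow> y < z + \<delta> \<longrightarrow> 0 < h y))"
    (is "_ \<longleftrightarrow> _ \<and> ?R")
proof
  assume z: "z \<in> up_zeros h"
  then obtain \<delta> where \<delta>: "\<delta> > 0" "\<forall>x\<in>{z - \<delta><..<z}. \<forall>y\<in>{z<..<z + \<delta>}. h x < 0 \<and> 0 < h y"
    unfolding up_zeros_def by blast
  \<comment> \<open>Both one-sided windows are nonempty, which lets the joint sign condition
    split.\<close>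
  have "z - \<delta>/2 \<in> {z - \<delta><..<z}" "z + \<delta>/2 \<in> {z<..<z + \<delta>}" using \<delta>(1) by auto
  then have ?R using \<delta> by (intro exI[of _ \<delta>]) fastforce
  then show "h z = 0 \<and> ?R" using z by (simp add: up_zeros_def nondeg_zeros_def)
next
  assume "h z = 0 \<and> ?R"
  then obtain \<delta> where "h z = 0" "\<delta> > 0" "\<forall>x\<in>{z - \<delta><..<z}. \<forall>y\<in>{z<..<z + \<delta>}. h x < 0 \<and> 0 < h y"
    by auto
  then show "z \<in> up_zeros h"
    unfolding up_zeros_def nondeg_zeros_def by (blast intro: mult_neg_pos)
qed

lemma up_zeros_shift:
  assumes "\<And>t. h (t + T) = h t" "z \<in> up_zeros h"
  shows "z + T \<in> up_zeros h"
proof -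
  have eq: "h x = h (x - T)" for x using assms(1)[of "x - T"] by simp
  from assms(2) obtain \<delta> where "h z = 0" "\<delta> > 0" "\<forall>x. z - \<delta> < x \<longrightarrow> x < z \<longrightarrow> h x < 0"
      "\<forall>y. z < y \<longrightarrow> y < z + \<delta> \<longrightarrow> 0 < h y"
    unfolding up_zeros_iff by blast
  then show ?thesis
    unfolding up_zeros_iff using assms(1)
    by (intro conjI exI[of _ \<delta>]) (auto, (subst eq, simp)+)
qed

text \<open>Sign data on one half period that control zeros and crossings everywhere.
  \<open>\<sigma>\<close> is only a candidate: it need not be a zero or lie in the interval.\<close>

locale antiperiodic_sign =
  fixes h :: "real \<Rightarrow> real" and \<alpha> \<sigma> :: real
  assumes anti: "h t = - h (t + 1/2)"
    and phase: "h \<alpha> = 0"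
    and nonneg: "\<alpha> < t \<Longrightarrow> t < \<alpha> + 1/2 \<Longrightarrow> 0 \<le> h t"
    and zero: "\<alpha> < t \<Longrightarrow> t < \<alpha> + 1/2 \<Longrightarrow> h t = 0 \<Longrightarrow> t = \<sigma>"
begin

lemma periodic_one: "h (t + 1) = h t"
  using anti[of t] anti[of "t + 1/2"] by (simp add: add.assoc)

lemma periodic_nat: "h (t + real n) = h t"
proof (induction n)
  case (Suc n)
  then show ?case using periodic_one[of "t + real n"] by (simp add: algebra_simps)
qed simp

lemma periodic_int: "h (t + of_int n) = h t"
  using periodic_nat[of t "nat n"] periodic_nat[of "t + of_int n" "nat (- n)"]
  by (cases "0 \<le> n") auto

lemma nonpos:
  assumes "\<alpha> - 1/2 < t" "t < \<alpha>" shows "h t \<le> 0"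
  using anti[of t] nonneg[of "t + 1/2"] assms by simp

lemma shift_into_period:
  obtains n :: int where "\<alpha> - 1/2 \<le> t - of_int n" "t - of_int n < \<alpha> + 1/2"
proof -
  have "\<alpha> - 1/2 \<le> t - of_int \<lfloor>t - \<alpha> + 1/2\<rfloor>" "t - of_int \<lfloor>t - \<alpha> + 1/2\<rfloor> < \<alpha> + 1/2"
    by linarith+
  then show ?thesis by (rule that)
qed

text \<open>Zeros before \<open>\<alpha>\<close> are half-period translates of zeros after
  it.\<close>

lemma zeros_in_period:
  assumes "h t = 0" "\<alpha> - 1/2 \<le> t" "t < \<alpha> + 1/2"
  shows "t \<in> {\<alpha> - 1/2, \<alpha>, \<sigma>, \<sigma> - 1/2}"
  using assms zero[of t] zero[of "t + 1/2"] anti[of t] by (cases t \<alpha> rule: linorder_cases) force+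

lemma finite_zeros: "finite {t \<in> {a..<b}. h t = 0}"
proof -
  define Z where "Z = {\<alpha> - 1/2, \<alpha>, \<sigma>, \<sigma> - 1/2}"
  have "{t \<in> {a..<b}. h t = 0} \<subseteq>
      (\<lambda>(z, n). z + of_int n) ` (Z \<times> {\<lfloor>a - \<alpha> - 1/2\<rfloor>..\<lceil>b - \<alpha> + 1/2\<rceil>})"
  proof
    fix t assume t: "t \<in> {t \<in> {a..<b}. h t = 0}"
    obtain n :: int where n: "\<alpha> - 1/2 \<le> t - of_int n" "t - of_int n < \<alpha> + 1/2"
      by (rule shift_into_period)
    have "t - of_int n \<in> Z" unfolding Z_def
      using t n periodic_int[of "t - of_int n" n] by (intro zeros_in_period) auto
    moreover have "n \<in> {\<lfloor>a - \<alpha> - 1/2\<rfloor>..\<lceil>b - \<alpha> + 1/2\<rceil>}"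
      using t n by simp linarith
    ultimately show "t \<in> (\<lambda>(z, n). z + of_int n) ` (Z \<times> {\<lfloor>a - \<alpha> - 1/2\<rfloor>..\<lceil>b - \<alpha> + 1/2\<rceil>})"
      by (intro image_eqI[of _ _ "(t - of_int n, n)"]) auto
  qed
  then show ?thesis by (rule finite_subset) (simp add: Z_def)
qed

lemma countable_zeros: "countable {t. h t = 0}"
proof -
  have "{t. h t = 0} = (\<Union>n::nat. {t \<in> {- real n..<real n}. h t = 0})"
  proof -
    have "\<exists>n::nat. - real n \<le> t \<and> t < real n" for t :: real
      using reals_Archimedean2[of "\<bar>t\<bar>"] by (metis abs_less_iff less_imp_le minus_less_iff)
    then show ?thesis by auto
  qed
  then show ?thesis using finite_zeros by (simp add: countable_finite)
qed

lemma phase_up: "\<alpha> \<in> up_zeros h"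
proof -
  \<comment> \<open>A radius that avoids every candidate zero other than \<open>\<alpha>\<close>;
    removing \<open>\<alpha>\<close> itself keeps the minimum positive.\<close>
  define d where "d = Min (insert (1/2) ((\<lambda>z. \<bar>z - \<alpha>\<bar>) ` ({\<sigma>, \<sigma> - 1/2} - {\<alpha>})))"
  have d: "0 < d" unfolding d_def by (subst Min_gr_iff) auto
  have "d \<le> 1/2" "\<sigma> \<noteq> \<alpha> \<Longrightarrow> d \<le> \<bar>\<sigma> - \<alpha>\<bar>" "\<sigma> - 1/2 \<noteq> \<alpha> \<Longrightarrow> d \<le> \<bar>\<sigma> - 1/2 - \<alpha>\<bar>"
    unfolding d_def by (intro Min_le; force)+
  then have "h x < 0 \<and> 0 < h y" if "x \<in> {\<alpha> - d<..<\<alpha>}" "y \<in> {\<alpha><..<\<alpha> + d}" for x y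
  proof -
    have "h x \<noteq> 0" "h y \<noteq> 0"
      using zeros_in_period[of x] zeros_in_period[of y] zero[of y] zero[of "x + 1/2"] anti[of x] that \<open>d \<le> 1/2\<close>
        \<open>\<sigma> \<noteq> \<alpha> \<Longrightarrow> d \<le> \<bar>\<sigma> - \<alpha>\<bar>\<close> \<open>\<sigma> - 1/2 \<noteq> \<alpha> \<Longrightarrow> d \<le> \<bar>\<sigma> - 1/2 - \<alpha>\<bar>\<close>
      by (auto simp: abs_if split: if_splits)
    then show ?thesis using nonpos[of x] nonneg[of y] that \<open>d \<le> 1/2\<close> by auto
  qed
  then show ?thesis
    unfolding up_zeros_def nondeg_zeros_def using d phase
    by (blast intro: mult_neg_pos)
qed

text \<open>Modulo 1, points before \<open>\<alpha>\<close> have nonpositive values just to their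
  right and points after it nonnegative values just to their left, so only \<open>\<alpha>\<close>
  can be an upward crossing.\<close>

lemma up_zero_imp:
  assumes "z \<in> up_zeros h"
  obtains n :: int where "z = \<alpha> + of_int n"
proof -
  obtain n :: int where n: "\<alpha> - 1/2 \<le> z - of_int n" "z - of_int n < \<alpha> + 1/2"
    by (rule shift_into_period)
  define w where "w = z - of_int n"
  have "w \<in> up_zeros h"
    using up_zeros_shift[of h "of_int (- n)" z] assms periodic_int[of _ "- n"] by (simp add: w_def)
  then obtain \<delta> where \<delta>: "0 < \<delta>" "\<And>x. w - \<delta> < x \<Longrightarrow> x < w \<Longrightarrow> h x < 0"
      "\<And>y. w < y \<Longrightarrow> y < w + \<delta> \<Longrightarrow> 0 < h y"
    unfolding up_zeros_iff by blast
  have "w = \<alpha>"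
  proof (cases w \<alpha> rule: linorder_cases)
    case less
    then obtain y where "w < y" "y < min (w + \<delta>) \<alpha>" using \<delta>(1) dense[of w "min (w + \<delta>) \<alpha>"] by auto
    then show ?thesis using \<delta>(3)[of y] nonpos[of y] n by (simp add: w_def)
  next
    case greater
    then obtain x where "max (w - \<delta>) \<alpha> < x" "x < w" using \<delta>(1) dense[of "max (w - \<delta>) \<alpha>" w] by auto
    then show ?thesis using \<delta>(2)[of x] nonneg[of x] n by (simp add: w_def)
  qed
  then show ?thesis using that[of n] by (simp add: w_def)
qed

lemma phase_shift_up: "\<alpha> + of_int n \<in> up_zeros h"
  using up_zeros_shift[OF _ phase_up] periodic_int by blast

lemma ex1_up_zero: "\<exists>!z. z \<in> {a..<a + 1} \<and> z \<in> up_zeros h"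
proof (intro ex1I conjI)
  show "\<alpha> + of_int \<lceil>a - \<alpha>\<rceil> \<in> {a..<a + 1}" by simp linarith
  show "\<alpha> + of_int \<lceil>a - \<alpha>\<rceil> \<in> up_zeros h" by (rule phase_shift_up)
  fix z assume z: "z \<in> {a..<a + 1} \<and> z \<in> up_zeros h"
  then obtain n where n: "z = \<alpha> + of_int n" using up_zero_imp by blast
  then have "n = \<lceil>a - \<alpha>\<rceil>" using z by (intro ceiling_unique[symmetric]) auto
  then show "z = \<alpha> + of_int \<lceil>a - \<alpha>\<rceil>" using n by simp
qed

text \<open>A smaller period \<open>T\<close> would make \<open>\<alpha> + T\<close> an upward
  crossing, but crossings differ by integers.\<close>

lemma prime_period_one: "prime_period 1 h"
  unfolding prime_period_def
proof (intro conjI allI impI)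
  fix T :: real assume T: "0 < T \<and> T < 1"
  show "\<exists>t. h (t + T) \<noteq> h t"
  proof (rule ccontr)
    assume "\<not> ?thesis"
    then have "\<alpha> + T \<in> up_zeros h" by (intro up_zeros_shift phase_up) auto
    then obtain n :: int where "\<alpha> + T = \<alpha> + of_int n" by (rule up_zero_imp)
    then have "0 < real_of_int n" "real_of_int n < 1" using T by auto
    then show False by simp
  qed
qed (simp_all add: periodic_one)

end

text \<open>Modulo full turns the angle is within \<open>pi/2\<close> of \<open>pi\<close>. This
  sign makes \<open>v\<close> nonnegative.\<close>

lemma cos_phase_nonpos:
  assumes "\<alpha> - of_int n \<in> {1/4..3/4}"
  shows "cos (2 * pi * \<alpha>) \<le> 0"
proof -
  define y where "y = 2 * pi * (\<alpha> - of_int n) - pi"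
  have "2 * pi * \<alpha> = (y + pi) + 2 * pi * of_int n" by (simp add: y_def algebra_simps)
  then have "cos (2 * pi * \<alpha>) = - cos y"
    by (simp only: cos_add[of "y + pi"] cos_int_2pin sin_int_2pin) simp
  moreover have "2 * pi * (1/4) \<le> 2 * pi * (\<alpha> - of_int n)" "2 * pi * (\<alpha> - of_int n) \<le> 2 * pi * (3/4)"
    using assms by (intro mult_left_mono; simp)+
  then have "0 \<le> cos y" unfolding y_def by (intro cos_ge_zero) linarith+
  ultimately show ?thesis by simp
qed

section \<open>The periodic orbit\<close>

locale orbit =
  fixes \<theta> c \<alpha> :: real
  assumes \<theta>: "0 \<le> \<theta>" "\<theta> \<le> 1/2"
    and c: "0 \<le> c"
    and cos_phase: "cos (2 * pi * \<alpha>) \<le> 0"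
    and sin_phase: "c * sin (2 * pi * \<alpha>) = u_fun \<theta>"
    and region: "(\<theta>, c) \<in> region_S"
begin

text \<open>The peak of the piecewise linear \<open>p\<close> is \<open>\<theta>\<close>, at \<open>\<alpha> + \<theta>\<close>.\<close>
definition p :: "real \<Rightarrow> real" where
  "p t = \<theta> - wave (t - \<alpha> - \<theta>)"

definition h :: "real \<Rightarrow> real" where
  "h t = p t + c / (2 * pi) * (sin (2 * pi * t) - sin (2 * pi * \<alpha>))"

definition v :: real where
  "v = - c * cos (2 * pi * \<alpha>)"

text \<open>The argument of \<open>wave\<close> is within 1/2 of 0 on the first two pieces and of 1
  on the third.\<close>

lemma p_rise: "\<alpha> \<le> t \<Longrightarrow> t \<le> \<alpha> + \<theta> \<Longrightarrow> p t = t - \<alpha>"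
  using \<theta> wave_eq[of "t - \<alpha> - \<theta>" 0] by (simp add: p_def)

lemma p_fall: "\<alpha> + \<theta> \<le> t \<Longrightarrow> t \<le> \<alpha> + \<theta> + 1/2 \<Longrightarrow> p t = 2 * \<theta> - t + \<alpha>"
  using \<theta> wave_eq[of "t - \<alpha> - \<theta>" 0] by (simp add: p_def)

lemma p_rise_again: "\<alpha> + \<theta> + 1/2 \<le> t \<Longrightarrow> t \<le> \<alpha> + 1 \<Longrightarrow> p t = -1 + t - \<alpha>"
  using \<theta> wave_eq[of "t - \<alpha> - \<theta>" 1] by (simp add: p_def)

lemma p_periodic: "p (t + 1) = p t"
  using wave_add_int[of "t - \<alpha> - \<theta>" 1] by (simp add: p_def algebra_simps)

text \<open>The phase condition says exactly that the constant
  \<open>c / (2 * pi) * sin (2 * pi * \<alpha>)\<close> cancels the mean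
  \<open>\<theta> - 1/4\<close> of \<open>p\<close>.\<close>

lemma h_antiperiodic: "h t = - h (t + 1/2)"
proof -
  have "p t + p (t + 1/2) = 2 * \<theta> - 1/2"
    using wave_add_half[of "t - \<alpha> - \<theta>"] by (simp add: p_def algebra_simps)
  moreover have "sin (2 * pi * (t + 1/2)) = - sin (2 * pi * t)"
    by (simp add: distrib_left)
  moreover have "c / (2 * pi) * sin (2 * pi * \<alpha>) = \<theta> - 1/4"
    using sin_phase by (simp add: u_fun_def field_simps)
  ultimately show ?thesis
    by (simp add: h_def right_diff_distrib)
qed

lemma h_scaled: "2 * pi * h t = 2 * pi * p t + c * (sin (2 * pi * t) - sin (2 * pi * \<alpha>))"
  unfolding h_def distrib_left by simp

lemma forcing_shift:
  "c * (sin (2 * pi * (\<alpha> + s)) - sin (2 * pi * \<alpha>)) = - u_fun \<theta> * (1 - cos (2 * pi * s)) - v * sin (2 * pi * s)"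
  unfolding distrib_left sin_add sin_phase[symmetric] v_def by (simp add: algebra_simps)

lemma h_rise:
  assumes "0 \<le> s" "s \<le> \<theta>"
  shows "2 * pi * h (\<alpha> + s) = gap (u_fun \<theta>) v (2 * pi * s)"
proof -
  have "2 * pi * h (\<alpha> + s) = 2 * pi * s + c * (sin (2 * pi * (\<alpha> + s)) - sin (2 * pi * \<alpha>))"
    unfolding h_scaled using assms p_rise[of "\<alpha> + s"] by simp
  then show ?thesis unfolding forcing_shift by (simp add: gap_def)
qed

text \<open>Since \<open>4 * pi * \<theta> = 2 * u_fun \<theta> + pi\<close>, reflecting the angle
  at \<open>pi/2\<close> flips the cosine and restores the gap form.\<close>

lemma h_fall:
  assumes "\<theta> \<le> s" "s \<le> 1/2"
  shows "2 * pi * h (\<alpha> + s) = gap (- u_fun \<theta>) v (pi - 2 * pi * s)"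
proof -
  have "2 * pi * h (\<alpha> + s) = 2 * pi * (2 * \<theta> - s) + c * (sin (2 * pi * (\<alpha> + s)) - sin (2 * pi * \<alpha>))"
    unfolding h_scaled using assms \<theta> p_fall[of "\<alpha> + s"] by simp
  also have "2 * pi * (2 * \<theta> - s) = 2 * u_fun \<theta> + pi - 2 * pi * s"
    by (simp add: u_fun_def algebra_simps)
  finally show ?thesis unfolding forcing_shift by (simp add: gap_def algebra_simps)
qed

text \<open>For \<open>\<theta> \<ge> 1/4\<close> only the first gap can vanish, otherwise only the
  second, so one \<open>\<sigma>\<close> serves both pieces.\<close>

lemma gap_signs:
  obtains \<sigma> where
    "\<And>s. 0 < s \<Longrightarrow> s < 1/2 \<Longrightarrow> 0 \<le> gap (u_fun \<theta>) v (2 * pi * s) \<and> 0 \<le> gap (- u_fun \<theta>) v (pi - 2 * pi * s)"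
    "\<And>s. 0 < s \<Longrightarrow> s < 1/2 \<Longrightarrow>
       gap (u_fun \<theta>) v (2 * pi * s) = 0 \<or> gap (- u_fun \<theta>) v (pi - 2 * pi * s) = 0 \<Longrightarrow> s = \<sigma>"
proof -
  have v0: "0 \<le> v" using c cos_phase by (simp add: v_def mult_nonneg_nonpos)
  have norm: "(u_fun \<theta>)\<^sup>2 + v\<^sup>2 = c\<^sup>2"
  proof -
    have "(u_fun \<theta>)\<^sup>2 + v\<^sup>2 = c\<^sup>2 * ((sin (2 * pi * \<alpha>))\<^sup>2 + (cos (2 * pi * \<alpha>))\<^sup>2)"
      unfolding v_def sin_phase[symmetric] by algebra
    then show ?thesis by simp
  qed
  have range: "0 < 2 * pi * s" "2 * pi * s \<le> pi" "0 < pi - 2 * pi * s" "pi - 2 * pi * s \<le> pi"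
    if "0 < s" "s < 1/2" for s
    using that mult_strict_left_mono[OF that(2), of "2 * pi"] by auto
  show ?thesis
  proof (cases "1/4 \<le> \<theta>")
    case True
    then have "\<theta> \<in> {1/4..theta_hat}" "c\<^sup>2 \<le> w_plus_sq \<theta>" using region by (auto simp: region_S_def)
    then obtain \<psi> where \<psi>: "\<And>x. 0 < x \<Longrightarrow> x \<le> pi \<Longrightarrow>
        0 \<le> gap (u_fun \<theta>) v x \<and> (gap (u_fun \<theta>) v x = 0 \<longrightarrow> x = \<psi>) \<and> 0 < gap (- u_fun \<theta>) v x"
      using gap_nonneg_of_region[of \<theta> v] v0 norm by metis
    show ?thesis
    proof (rule that[of "\<psi> / (2 * pi)"])
      fix s :: real assume s: "0 < s" "s < 1/2"
      show "0 \<le> gap (u_fun \<theta>) v (2 * pi * s) \<and> 0 \<le> gap (- u_fun \<theta>) v (pi - 2 * pi * s)"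
        using \<psi> range[OF s] less_imp_le by blast
      assume "gap (u_fun \<theta>) v (2 * pi * s) = 0 \<or> gap (- u_fun \<theta>) v (pi - 2 * pi * s) = 0"
      then have "2 * pi * s = \<psi>" using \<psi> range[OF s] less_irrefl by metis
      then show "s = \<psi> / (2 * pi)" by (simp add: field_simps)
    qed
  next
    case False
    define \<theta>' where "\<theta>' = 1/2 - \<theta>"
    have u': "u_fun \<theta>' = - u_fun \<theta>" by (simp add: \<theta>'_def u_fun_def algebra_simps)
    have "\<theta>' \<in> {1/4..theta_hat}" "c\<^sup>2 \<le> w_plus_sq \<theta>'"
      using False region by (auto simp: region_S_def \<theta>'_def)
    then obtain \<psi> where \<psi>: "\<And>x. 0 < x \<Longrightarrow> x \<le> pi \<Longrightarrow>
        0 \<le> gap (- u_fun \<theta>) v x \<and> (gap (- u_fun \<theta>) v x = 0 \<longrightarrow> x = \<psi>) \<and> 0 < gap (u_fun \<theta>) v x"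
      using gap_nonneg_of_region[of \<theta>' v] v0 norm unfolding u' by (metis minus_minus power2_minus)
    show ?thesis
    \<comment> \<open>The possible zero now belongs to the gap evaluated at
      \<open>pi - 2 * pi * s\<close>.\<close>
    proof (rule that[of "(pi - \<psi>) / (2 * pi)"])
      fix s :: real assume s: "0 < s" "s < 1/2"
      show "0 \<le> gap (u_fun \<theta>) v (2 * pi * s) \<and> 0 \<le> gap (- u_fun \<theta>) v (pi - 2 * pi * s)"
        using \<psi> range[OF s] less_imp_le by blast
      assume "gap (u_fun \<theta>) v (2 * pi * s) = 0 \<or> gap (- u_fun \<theta>) v (pi - 2 * pi * s) = 0"
      then have "pi - 2 * pi * s = \<psi>" using \<psi> range[OF s] less_irrefl by metis
      then show "s = (pi - \<psi>) / (2 * pi)" by (simp add: field_simps)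
    qed
  qed
qed

lemma h_antiperiodic_sign: "\<exists>\<sigma>. antiperiodic_sign h \<alpha> \<sigma>"
proof -
  obtain \<sigma> where nonneg: "\<And>s. 0 < s \<Longrightarrow> s < 1/2 \<Longrightarrow>
        0 \<le> gap (u_fun \<theta>) v (2 * pi * s) \<and> 0 \<le> gap (- u_fun \<theta>) v (pi - 2 * pi * s)"
    and zero: "\<And>s. 0 < s \<Longrightarrow> s < 1/2 \<Longrightarrow>
       gap (u_fun \<theta>) v (2 * pi * s) = 0 \<or> gap (- u_fun \<theta>) v (pi - 2 * pi * s) = 0 \<Longrightarrow> s = \<sigma>"
    by (rule gap_signs) blast
  have "antiperiodic_sign h \<alpha> (\<alpha> + \<sigma>)"
  proof
    show "h t = - h (t + 1/2)" for t by (rule h_antiperiodic)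
    show "h \<alpha> = 0" using p_rise[of \<alpha>] \<theta> by (simp add: h_def)
    fix t assume t: "\<alpha> < t" "t < \<alpha> + 1/2"
    define s where "s = t - \<alpha>"
    have s: "0 < s" "s < 1/2" "t = \<alpha> + s" using t by (auto simp: s_def)
    have h: "2 * pi * h t = gap (u_fun \<theta>) v (2 * pi * s) \<or> 2 * pi * h t = gap (- u_fun \<theta>) v (pi - 2 * pi * s)"
      using s h_rise[of s] h_fall[of s] by (cases "s \<le> \<theta>") auto
    then have "0 \<le> 2 * pi * h t" using nonneg[of s] s by metis
    then show "0 \<le> h t" using pi_gt_zero by (simp add: zero_le_mult_iff)
    show "t = \<alpha> + \<sigma>" if "h t = 0"
      using h zero[of s] s that by auto
  qed
  then show ?thesis ..
qed

section \<open>Regularity and the delay equation\<close>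

lemma h_lipschitz: "\<bar>h x - h y\<bar> \<le> (1 + c) * \<bar>x - y\<bar>"
proof -
  have "c / (2 * pi) * \<bar>sin (2 * pi * x) - sin (2 * pi * y)\<bar> \<le> c / (2 * pi) * \<bar>2 * pi * x - 2 * pi * y\<bar>"
    using c by (intro mult_left_mono abs_sin_diff_le) auto
  also have "\<bar>2 * pi * x - 2 * pi * y\<bar> = 2 * pi * \<bar>x - y\<bar>"
    unfolding right_diff_distrib[symmetric] by (simp add: abs_mult)
  finally have "\<bar>c / (2 * pi) * (sin (2 * pi * x) - sin (2 * pi * y))\<bar> \<le> c * \<bar>x - y\<bar>"
    using c by (simp add: abs_mult)
  moreover have "\<bar>p x - p y\<bar> \<le> \<bar>x - y\<bar>"
    using wave_lipschitz[of "x - \<alpha> - \<theta>" "y - \<alpha> - \<theta>"] by (simp add: p_def)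
  moreover have "h x - h y = (p x - p y) + c / (2 * pi) * (sin (2 * pi * x) - sin (2 * pi * y))"
    by (simp add: h_def algebra_simps)
  ultimately show ?thesis unfolding distrib_right mult_1 by linarith
qed

lemma h_derivative:
  assumes "(wave has_real_derivative D) (at (t - \<alpha> - \<theta>))"
  shows "(h has_real_derivative - D + c * cos (2 * pi * t)) (at t)"
proof -
  have "((\<lambda>t. wave (t - \<alpha> - \<theta>)) has_real_derivative D * 1) (at t)"
    by (rule DERIV_chain2[where g = "\<lambda>t. t - \<alpha> - \<theta>", OF assms]) (auto intro!: derivative_eq_intros)
  then show ?thesis
    unfolding h_def p_def by (auto intro!: derivative_eq_intros simp: field_simps)
qed

text \<open>By periodicity \<open>k\<close> drops out of the delayed argument. Off the zeros, the
  sign of \<open>h\<close> at \<open>t - \<theta>\<close> tells on which side of an integer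
  \<open>t - \<alpha> - \<theta>\<close> lies, and that side fixes the slope of
  \<open>wave\<close>.\<close>

lemma h_solution: "dde_solution (real k + \<theta>) c h"
proof -
  obtain \<sigma> where "antiperiodic_sign h \<alpha> \<sigma>" using h_antiperiodic_sign ..
  then interpret antiperiodic_sign h \<alpha> \<sigma> .
  have "{t. h (t - (real k + \<theta>)) = 0} \<subseteq> (\<lambda>z. z + (real k + \<theta>)) ` {t. h t = 0}"
    by (auto intro!: image_eqI[of _ _ "_ - (real k + \<theta>)"])
  then have "countable {t. h (t - (real k + \<theta>)) = 0}"
    by (rule countable_subset) (intro countable_image countable_zeros)
  then have "AE t in lborel. t \<notin> {t. h (t - (real k + \<theta>)) = 0}"
    by (intro AE_not_in countable_imp_null_set_lborel)
  then have "AE t in lborel.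
     (h has_real_derivative (- sgn (h (t - (real k + \<theta>))) + c * cos (2 * pi * t))) (at t)"
  proof (rule eventually_mono)
    fix t assume t: "t \<notin> {t. h (t - (real k + \<theta>)) = 0}"
    obtain n :: int where n: "\<alpha> - 1/2 \<le> (t - \<theta>) - of_int n" "(t - \<theta>) - of_int n < \<alpha> + 1/2"
      by (rule shift_into_period)
    define r where "r = (t - \<theta>) - of_int n"
    have hr: "h (t - (real k + \<theta>)) = h r"
      using periodic_nat[of "t - (real k + \<theta>)" k] periodic_int[of r n] by (simp add: r_def)
    \<comment> \<open>The corners of \<open>wave\<close> correspond to zeros of the delayed term,
      hence are already excluded.\<close>
    have "h (\<alpha> - 1/2) = 0" using anti[of "\<alpha> - 1/2"] phase by simp
    then have "r \<noteq> \<alpha>" "r \<noteq> \<alpha> - 1/2" "h r \<noteq> 0" using t hr phase by auto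
    then consider "\<alpha> < r" | "\<alpha> - 1/2 < r" "r < \<alpha>" using n unfolding r_def[symmetric] by linarith
    then have "(wave has_real_derivative sgn (h r)) (at (t - \<alpha> - \<theta>))"
    proof cases
      case 1
      then have "0 < h r" using nonneg[of r] n \<open>h r \<noteq> 0\<close> by (simp add: r_def)
      then show ?thesis using 1 n wave_deriv_up[of n "t - \<alpha> - \<theta>"] by (simp add: r_def)
    next
      case 2
      then have "h r < 0" using nonpos[of r] n \<open>h r \<noteq> 0\<close> by (simp add: r_def)
      then show ?thesis using 2 n wave_deriv_down[of n "t - \<alpha> - \<theta>"] by (simp add: r_def)
    qed
    then show "(h has_real_derivative (- sgn (h (t - (real k + \<theta>))) + c * cos (2 * pi * t))) (at t)"
      unfolding hr by (rule h_derivative)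
  qed
  then show ?thesis
    unfolding dde_solution_def
    using lipschitz_imp_locally_abs_continuous[of h "1 + c"] h_lipschitz by blast
qed

end

theorem theorem3p10:
  fixes k :: nat and \<theta> \<tau> c \<alpha> :: real
  assumes "\<theta> \<in> {0..1/2}"
    and "\<tau> = real k + \<theta>"
    and "\<exists>n::int. \<alpha> - of_int n \<in> {1/4..3/4}"
    and "c * sin (2 * pi * \<alpha>) = u_fun \<theta>"
    and "(\<theta>, c) \<in> region_S"
  shows "\<exists>h p :: real \<Rightarrow> real.
    periodic_orbit_11 \<tau> c h \<and> symmetric_orbit h \<and> is_phase h \<alpha> \<and>
    (\<forall>t. h t = p t + c / (2 * pi) * (sin (2 * pi * t) - sin (2 * pi * \<alpha>))) \<and>
    (\<forall>t. p (t + 1) = p t) \<and>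
    (\<forall>t\<in>{\<alpha>..<\<alpha> + \<theta>}. p t = t - \<alpha>) \<and>
    (\<forall>t\<in>{\<alpha> + \<theta>..<\<alpha> + \<theta> + 1/2}. p t = 2 * \<theta> - t + \<alpha>) \<and>
    (\<forall>t\<in>{\<alpha> + \<theta> + 1/2..<\<alpha> + 1}. p t = -1 + t - \<alpha>)"
proof -
  obtain n :: int where "\<alpha> - of_int n \<in> {1/4..3/4}" using assms(3) ..
  then interpret orbit \<theta> c \<alpha>
    using assms(1,4,5) cos_phase_nonpos by unfold_locales (auto simp: region_S_def)
  obtain \<sigma> where "antiperiodic_sign h \<alpha> \<sigma>" using h_antiperiodic_sign ..
  then interpret antiperiodic_sign h \<alpha> \<sigma> .
  show ?thesis
  proof (rule exI[of _ h], rule exI[of _ p], intro conjI)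
    show "periodic_orbit_11 \<tau> c h"
      unfolding periodic_orbit_11_def
      using h_solution[of k] prime_period_one finite_zeros ex1_up_zero assms(2) by blast
    show "symmetric_orbit h" unfolding symmetric_orbit_def using anti by blast
    show "is_phase h \<alpha>" unfolding is_phase_def by (rule phase_up)
  qed (auto simp: h_def p_periodic p_rise p_fall p_rise_again)
qed

end
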